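(* Let $k$ be a field of characteristic $p>0$, let $d_1,\ldots,d_n$ be positive integers, let $A = k[x_1,\ldots,x_n]/(x_1^{d_1}, \ldots, x_n^{d_n})$ and $t = \sum_{i = 1}^n (d_i-1)$. If $\max(p,d_1, \ldots, d_n)>(t+1)/2$, then $A$ has the weak Lefschetz property.
   Context: $A$ is graded by degree, $A=\bigoplus_{i\ge0}A_i$. A graded artinian algebra $A$ has the weak Lefschetz property if there is a linear form $\ell\in A_1$ such that for every $i$ the map $A_i\to A_{i+1}$, $a\mapsto \ell a$, is injective or surjective. *)

theory Defs
  imports Complex_Main "HOL-Library.Poly_Mapping"
begin

text \<open>Polynomials over a commutative ring 'k in countably many variables x_0, x_1, ...
  are modelled as finitely supported maps from monomials (exponent vectors) to coefficients.  The ring k[x_1,...,x_n] is the subring of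
  polynomials involving only the variables x_0,...,x_(n-1).\<close>

type_synonym 'k mpoly = "(nat \<Rightarrow>\<^sub>0 nat) \<Rightarrow>\<^sub>0 'k"

definition var :: "nat \<Rightarrow> ('k::comm_ring_1) mpoly" where
  "var j = Poly_Mapping.single (Poly_Mapping.single j 1) 1"

definition const :: "'k::comm_ring_1 \<Rightarrow> 'k mpoly" where
  "const c = Poly_Mapping.single 0 c"

definition in_vars :: "nat \<Rightarrow> ('k::comm_ring_1) mpoly \<Rightarrow> bool" where
  "in_vars n f \<longleftrightarrow> (\<forall>m\<in>Poly_Mapping.keys f. Poly_Mapping.keys m \<subseteq> {..<n})"

definition mdeg :: "(nat \<Rightarrow>\<^sub>0 nat) \<Rightarrow> nat" where
  "mdeg m = (\<Sum>j\<in>Poly_Mapping.keys m. Poly_Mapping.lookup m j)"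

text \<open>f is homogeneous of degree i (the zero polynomial is homogeneous of every degree)\<close>
definition homog :: "nat \<Rightarrow> ('k::comm_ring_1) mpoly \<Rightarrow> bool" where
  "homog i f \<longleftrightarrow> (\<forall>m\<in>Poly_Mapping.keys f. mdeg m = i)"

definition in_ideal :: "nat \<Rightarrow> (nat \<Rightarrow> nat) \<Rightarrow> ('k::comm_ring_1) mpoly \<Rightarrow> bool" where
  "in_ideal n d f \<longleftrightarrow>
     (\<exists>g. (\<forall>j<n. in_vars n (g j)) \<and> f = (\<Sum>j<n. g j * var j ^ d j))"

text \<open>Homogeneous polynomials of degree i in k[x_0,...,x_(n-1)]; their images in
  A = k[x]/I form the graded component A_i.\<close>
definition homog_part :: "nat \<Rightarrow> nat \<Rightarrow> ('k::comm_ring_1) mpoly set" where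
  "homog_part n i = {f. in_vars n f \<and> homog i f}"

definition linform :: "nat \<Rightarrow> (nat \<Rightarrow> 'k::comm_ring_1) \<Rightarrow> 'k mpoly" where
  "linform n c = (\<Sum>j<n. const (c j) * var j)"

text \<open>Multiplication by l, as a map A_i \<rightarrow> A_(i+1), is injective / surjective.\<close>
definition mult_inj :: "nat \<Rightarrow> (nat \<Rightarrow> nat) \<Rightarrow> ('k::comm_ring_1) mpoly \<Rightarrow> nat \<Rightarrow> bool" where
  "mult_inj n d l i \<longleftrightarrow>
     (\<forall>f\<in>homog_part n i. in_ideal n d (l * f) \<longrightarrow> in_ideal n d f)"

definition mult_surj :: "nat \<Rightarrow> (nat \<Rightarrow> nat) \<Rightarrow> ('k::comm_ring_1) mpoly \<Rightarrow> nat \<Rightarrow> bool" where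
  "mult_surj n d l i \<longleftrightarrow>
     (\<forall>g\<in>homog_part n (Suc i). \<exists>f\<in>homog_part n i. in_ideal n d (g - l * f))"

definition has_WLP :: "'k::comm_ring_1 itself \<Rightarrow> nat \<Rightarrow> (nat \<Rightarrow> nat) \<Rightarrow> bool" where
  "has_WLP TYPE('k) n d \<longleftrightarrow>
     (\<exists>c :: nat \<Rightarrow> 'k. \<forall>i. mult_inj n d (linform n c) i \<or> mult_surj n d (linform n c) i)"

end

theory Submission
  imports Defs
begin

text \<open>If some exponent \<open>d l\<close> exceeds \<open>(t + 1) / 2\<close>, then \<open>d l - 1\<close> is at least the socle degree of
  the algebra on the remaining variables, and the variable \<open>x\<^sub>l\<close> itself is a Lefschetz element.

  Otherwise \<open>p > (t + 1) / 2\<close> and the sum of the variables works. Together with the operator sending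
  \<open>x\<^sub>j ^ e\<close> to \<open>e (d\<^sub>j - e) x\<^sub>j ^ (e - 1)\<close>, multiplication by it satisfies the commutation
  relations of the Lie algebra sl2, with weight \<open>t - 2 i\<close> in degree \<open>i\<close>. In the middle degrees all
  scalars occurring in the usual argument are invertible, except possibly at the end of a string, which
  lies in degree 0 or \<open>t\<close>; there one uses that the multinomial coefficients of the powers below \<open>p\<close>
  do not vanish. Injectivity propagates downwards since the socle lies in degree \<open>t\<close>,
  surjectivity upwards since the algebra is generated in degree one.

  Elements are represented by coefficient functions on monomials; such a function represents zero in
  the quotient iff it vanishes on the finite box of monomials with exponents below \<open>d\<close>.\<close>

definition unit_exp :: "nat \<Rightarrow> (nat \<Rightarrow>\<^sub>0 nat)" where
  "unit_exp j = Poly_Mapping.single j 1"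

lemma lookup_unit_exp [simp]: "Poly_Mapping.lookup (unit_exp j) i = (if i = j then 1 else 0)"
  by (simp add: unit_exp_def lookup_single when_def)

lemma keys_unit_exp [simp]: "Poly_Mapping.keys (unit_exp j) = {j}"
  by (simp add: unit_exp_def)

subsection \<open>Coefficients of products with monomials\<close>

lemma lookup_sum_single:
  assumes "finite S"
  shows "Poly_Mapping.lookup (\<Sum>m\<in>S. Poly_Mapping.single m (a m)) m = (if m \<in> S then a m else 0)"
  using assms by (simp add: lookup_sum lookup_single when_def sum.delta)

lemma sum_single_keys:
  fixes f :: "'a \<Rightarrow>\<^sub>0 'k::comm_monoid_add"
  shows "(\<Sum>m\<in>Poly_Mapping.keys f. Poly_Mapping.single m (Poly_Mapping.lookup f m)) = f"
  by (rule poly_mapping_eqI) (simp add: lookup_sum_single in_keys_iff)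

text \<open>After expanding \<open>f\<close> into monomials, cancellation of exponents leaves
  \<open>b\<close> as the one monomial of \<open>f\<close> that can reach
  \<open>a + b\<close>.\<close>

lemma lookup_single_times_add:
  fixes f :: "('a::cancel_comm_monoid_add) \<Rightarrow>\<^sub>0 ('k::comm_ring_1)"
  shows "Poly_Mapping.lookup (Poly_Mapping.single a c * f) (a + b) = c * Poly_Mapping.lookup f b"
proof -
  have "Poly_Mapping.lookup (Poly_Mapping.single a c * (\<Sum>m\<in>Poly_Mapping.keys f.
      Poly_Mapping.single m (Poly_Mapping.lookup f m))) (a + b) = c * Poly_Mapping.lookup f b"
    by (simp add: sum_distrib_left Poly_Mapping.mult_single lookup_sum lookup_single when_def
        sum.delta in_keys_iff)
  then show ?thesis by (simp add: sum_single_keys)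
qed

lemma lookup_single_times_eq_0:
  fixes f :: "('a::cancel_comm_monoid_add) \<Rightarrow>\<^sub>0 ('k::comm_ring_1)"
  assumes "\<And>b. m \<noteq> a + b"
  shows "Poly_Mapping.lookup (Poly_Mapping.single a c * f) m = 0"
proof -
  have "Poly_Mapping.lookup (Poly_Mapping.single a c * (\<Sum>m\<in>Poly_Mapping.keys f.
      Poly_Mapping.single m (Poly_Mapping.lookup f m))) m = 0"
    using assms[symmetric]
    by (force simp: sum_distrib_left Poly_Mapping.mult_single lookup_sum lookup_single when_def
        intro!: sum.neutral)
  then show ?thesis by (simp add: sum_single_keys)
qed

lemma var_power: "(var j :: 'k::comm_ring_1 mpoly) ^ e = Poly_Mapping.single (Poly_Mapping.single j e) 1"
proof (induction e)
  case 0
  then show ?case by simp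
next
  case (Suc e)
  then show ?case by (simp add: var_def Poly_Mapping.mult_single single_add [symmetric])
qed

lemma split_exponent:
  fixes m :: "nat \<Rightarrow>\<^sub>0 nat"
  assumes "e \<le> Poly_Mapping.lookup m j"
  shows "Poly_Mapping.single j e + (m - Poly_Mapping.single j e) = m"
  by (rule poly_mapping_eqI) (use assms in \<open>auto simp: lookup_add lookup_minus lookup_single when_def\<close>)

lemma keys_add_nat: "Poly_Mapping.keys (a + b :: nat \<Rightarrow>\<^sub>0 nat) = Poly_Mapping.keys a \<union> Poly_Mapping.keys b"
  by (auto simp: in_keys_iff lookup_add)

lemma mdeg_eq_sum:
  assumes "finite S" "Poly_Mapping.keys m \<subseteq> S"
  shows "mdeg m = (\<Sum>j\<in>S. Poly_Mapping.lookup m j)"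
  unfolding mdeg_def
  by (rule sum.mono_neutral_left) (use assms in \<open>auto simp: in_keys_iff\<close>)

lemma mdeg_add: "mdeg (a + b) = mdeg a + mdeg b"
proof -
  let ?S = "Poly_Mapping.keys a \<union> Poly_Mapping.keys b"
  have "mdeg a = (\<Sum>j\<in>?S. Poly_Mapping.lookup a j)" "mdeg b = (\<Sum>j\<in>?S. Poly_Mapping.lookup b j)"
    "mdeg (a + b) = (\<Sum>j\<in>?S. Poly_Mapping.lookup (a + b) j)"
    by (rule mdeg_eq_sum; force simp: keys_add_nat)+
  then show ?thesis by (simp add: lookup_add sum.distrib)
qed

lemma mdeg_zero [simp]: "mdeg 0 = 0"
  by (simp add: mdeg_def)

lemma mdeg_single [simp]: "mdeg (Poly_Mapping.single j e) = e"
  by (cases "e = 0") (auto simp: mdeg_def)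

lemma mdeg_unit_exp [simp]: "mdeg (unit_exp j) = 1"
  by (simp add: unit_exp_def)

lemma mdeg_eq_0_iff: "mdeg m = 0 \<longleftrightarrow> m = 0"
proof
  assume "mdeg m = 0"
  then show "m = 0" by (auto intro!: poly_mapping_eqI simp: mdeg_def in_keys_iff)
qed simp

subsection \<open>The monomial basis of the quotient\<close>

definition box :: "nat \<Rightarrow> (nat \<Rightarrow> nat) \<Rightarrow> (nat \<Rightarrow>\<^sub>0 nat) set" where
  "box n d = {m. Poly_Mapping.keys m \<subseteq> {..<n} \<and> (\<forall>j<n. Poly_Mapping.lookup m j < d j)}"

lemma finite_box: "finite (box n d)"
proof (rule finite_imageD)
  \<comment> \<open>The sum of all \<open>d j\<close> bounds every exponent, so the box embeds into
    a finite set: functions bounded on \<open>{..<n}\<close> and 0 elsewhere.\<close>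
  have "d x \<le> (\<Sum>j<n. d j)" if "x < n" for x
    using that by (intro member_le_sum) auto
  then have "Poly_Mapping.lookup m x < (\<Sum>j<n. d j)" if "m \<in> box n d" "x < n" for m x
    using that unfolding box_def mem_Collect_eq by (meson less_le_trans)
  moreover have "Poly_Mapping.lookup m x = 0" if "m \<in> box n d" "\<not> x < n" for m x
    using that unfolding box_def mem_Collect_eq by (meson in_keys_iff lessThan_iff subsetD)
  ultimately have "Poly_Mapping.lookup ` box n d \<subseteq>
      {f. \<forall>x. (x \<in> {..<n} \<longrightarrow> f x \<in> {..<\<Sum>j<n. d j}) \<and> (x \<notin> {..<n} \<longrightarrow> f x = 0)}"
    by auto
  then show "finite (Poly_Mapping.lookup ` box n d)"
    by (rule finite_subset) (rule finite_set_of_finite_funs; simp)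
  show "inj_on Poly_Mapping.lookup (box n d)"
    by (simp add: inj_on_def poly_mapping.lookup_inject)
qed

lemma in_ideal_zero: "in_ideal n d 0"
  unfolding in_ideal_def by (rule exI[of _ "\<lambda>_. 0"]) (simp add: in_vars_def)

lemma in_ideal_add:
  assumes "in_ideal n d f" "in_ideal n d g"
  shows "in_ideal n d (f + g)"
proof -
  obtain u v where u: "\<forall>j<n. in_vars n (u j)" "f = (\<Sum>j<n. u j * var j ^ d j)"
    and v: "\<forall>j<n. in_vars n (v j)" "g = (\<Sum>j<n. v j * var j ^ d j)"
    using assms unfolding in_ideal_def by blast
  have "in_vars n (u j + v j)" if "j < n" for j
    using u(1) v(1) that keys_add[of "u j" "v j"] unfolding in_vars_def by blast
  then show ?thesis
    unfolding in_ideal_def u(2) v(2)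
    by (intro exI[of _ "\<lambda>j. u j + v j"]) (simp add: distrib_right sum.distrib)
qed

lemma in_ideal_sum: "(\<And>x. x \<in> S \<Longrightarrow> in_ideal n d (f x)) \<Longrightarrow> in_ideal n d (\<Sum>x\<in>S. f x)"
  by (induction S rule: infinite_finite_induct) (auto simp: in_ideal_zero in_ideal_add)

text \<open>A monomial outside the box has some exponent at least \<open>d j\<close>, hence is a
  multiple of one generator; the other cofactors are taken to be 0.\<close>

lemma in_ideal_monomial:
  assumes "Poly_Mapping.keys m \<subseteq> {..<n}" "m \<notin> box n d"
  shows "in_ideal n d (Poly_Mapping.single m c)"
proof -
  obtain j where j: "j < n" "d j \<le> Poly_Mapping.lookup m j"
    using assms by (auto simp: box_def not_less)
  define m' where "m' = m - Poly_Mapping.single j (d j)"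
  have m: "Poly_Mapping.single j (d j) + m' = m"
    unfolding m'_def by (rule split_exponent) (rule j(2))
  have "Poly_Mapping.keys m' \<subseteq> {..<n}"
    using assms(1) unfolding m[symmetric] keys_add_nat by simp
  then have "in_vars n (Poly_Mapping.single m' c)"
    by (simp add: in_vars_def)
  moreover have "Poly_Mapping.single m c = Poly_Mapping.single m' c * var j ^ d j"
    using m by (simp add: var_power Poly_Mapping.mult_single add.commute[of m'])
  moreover have "(\<Sum>i<n. (if i = j then Poly_Mapping.single m' c else 0) * var i ^ d i)
      = Poly_Mapping.single m' c * var j ^ d j"
    using j(1) by (simp add: if_distrib if_distribR sum.delta cong: if_cong)
  ultimately show ?thesis
    unfolding in_ideal_def
    by (intro exI[of _ "\<lambda>i. if i = j then Poly_Mapping.single m' c else 0"])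
      (auto simp: in_vars_def)
qed

text \<open>The ideal is generated by monomials, so membership is decided monomial by
  monomial.\<close>

lemma in_ideal_iff:
  assumes "in_vars n f"
  shows "in_ideal n d f \<longleftrightarrow> (\<forall>m\<in>box n d. Poly_Mapping.lookup f m = 0)"
proof
  assume "in_ideal n d f"
  then obtain g where f: "f = (\<Sum>j<n. g j * var j ^ d j)"
    unfolding in_ideal_def by blast
  show "\<forall>m\<in>box n d. Poly_Mapping.lookup f m = 0"
  proof
    fix m assume m: "m \<in> box n d"
    have "Poly_Mapping.lookup (g j * var j ^ d j) m = 0" if "j < n" for j
    proof -
      have "m \<noteq> Poly_Mapping.single j (d j) + b" for b
        using m that by (auto simp: box_def lookup_add)
      then show ?thesis
        using lookup_single_times_eq_0 by (metis var_power mult.commute)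
    qed
    then show "Poly_Mapping.lookup f m = 0" by (simp add: f lookup_sum)
  qed
next
  assume 0: "\<forall>m\<in>box n d. Poly_Mapping.lookup f m = 0"
  have "in_ideal n d (\<Sum>m\<in>Poly_Mapping.keys f. Poly_Mapping.single m (Poly_Mapping.lookup f m))"
  proof (rule in_ideal_sum, rule in_ideal_monomial)
    fix m assume m: "m \<in> Poly_Mapping.keys f"
    show "Poly_Mapping.keys m \<subseteq> {..<n}" using assms m by (auto simp: in_vars_def)
    show "m \<notin> box n d" using 0 m by (auto simp: in_keys_iff)
  qed
  then show "in_ideal n d f" by (simp add: sum_single_keys)
qed

subsection \<open>Multiplication on coefficient functions\<close>

text \<open>Multiplication by the variable \<open>j\<close>. Exponent 0 is split off because
  subtraction of exponents is truncated.\<close>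

definition shift :: "nat \<Rightarrow> ((nat \<Rightarrow>\<^sub>0 nat) \<Rightarrow> 'k::zero) \<Rightarrow> (nat \<Rightarrow>\<^sub>0 nat) \<Rightarrow> 'k" where
  "shift j a m = (if Poly_Mapping.lookup m j = 0 then 0 else a (m - unit_exp j))"

definition raise :: "nat \<Rightarrow> (nat \<Rightarrow> 'k) \<Rightarrow> ((nat \<Rightarrow>\<^sub>0 nat) \<Rightarrow> 'k::comm_ring_1) \<Rightarrow> (nat \<Rightarrow>\<^sub>0 nat) \<Rightarrow> 'k" where
  "raise n c a m = (\<Sum>j<n. c j * shift j a m)"

text \<open>Degrees are integers so that lowering may pass below degree 0, where every graded
  function is zero.\<close>

definition graded :: "nat \<Rightarrow> int \<Rightarrow> ((nat \<Rightarrow>\<^sub>0 nat) \<Rightarrow> 'k::zero) \<Rightarrow> bool" where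
  "graded n i a \<longleftrightarrow> (\<forall>m. a m \<noteq> 0 \<longrightarrow> Poly_Mapping.keys m \<subseteq> {..<n} \<and> int (mdeg m) = i)"

definition zero_on_box :: "nat \<Rightarrow> (nat \<Rightarrow> nat) \<Rightarrow> ((nat \<Rightarrow>\<^sub>0 nat) \<Rightarrow> 'k::zero) \<Rightarrow> bool" where
  "zero_on_box n d a \<longleftrightarrow> (\<forall>m\<in>box n d. a m = 0)"

definition raise_inj :: "nat \<Rightarrow> (nat \<Rightarrow> nat) \<Rightarrow> (nat \<Rightarrow> 'k::comm_ring_1) \<Rightarrow> int \<Rightarrow> bool" where
  "raise_inj n d c i \<longleftrightarrow>
     (\<forall>a. graded n i a \<longrightarrow> zero_on_box n d (raise n c a) \<longrightarrow> zero_on_box n d a)"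

definition raise_surj :: "nat \<Rightarrow> (nat \<Rightarrow> nat) \<Rightarrow> (nat \<Rightarrow> 'k::comm_ring_1) \<Rightarrow> int \<Rightarrow> bool" where
  "raise_surj n d c i \<longleftrightarrow>
     (\<forall>g. graded n (i + 1) g \<longrightarrow>
       (\<exists>a. graded n i a \<and> zero_on_box n d (\<lambda>m. g m - raise n c a m)))"

lemma shift_add [simp]: "shift j a (m + unit_exp j) = a m"
  by (simp add: shift_def lookup_add)

lemma shift_eq_0 [simp]: "Poly_Mapping.lookup m j = 0 \<Longrightarrow> shift j a m = 0"
  by (simp add: shift_def)

text \<open>Trades truncated subtraction for a genuine predecessor: identities about
  \<open>shift\<close> are checked separately on monomials free of the variable and on its
  multiples.\<close>

lemma exponent_cases:
  obtains "Poly_Mapping.lookup m j = 0" | m' where "m = m' + unit_exp j"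
  by (metis split_exponent unit_exp_def add.commute less_one linorder_not_less)

lemma lookup_single_unit_times:
  fixes c :: "'k::comm_ring_1"
  shows
  "Poly_Mapping.lookup (Poly_Mapping.single (unit_exp j) c * f) m = c * shift j (Poly_Mapping.lookup f) m"
proof (cases rule: exponent_cases[of m j])
  case 1
  then have "m \<noteq> unit_exp j + b" for b by (auto simp: lookup_add)
  then show ?thesis using 1 lookup_single_times_eq_0[of m "unit_exp j" c f] by simp
next
  case (2 m')
  then show ?thesis
    using lookup_single_times_add[of "unit_exp j" c f m'] by (simp add: add.commute)
qed

lemma lookup_linform_times:
  "Poly_Mapping.lookup (linform n c * f) = raise n c (Poly_Mapping.lookup f)"
  by (rule ext) (simp add: linform_def sum_distrib_right lookup_sum const_def var_def
      Poly_Mapping.mult_single lookup_single_unit_times raise_def flip: unit_exp_def[simplified])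

lemma graded_D: "graded n i a \<Longrightarrow> a m \<noteq> 0 \<Longrightarrow> Poly_Mapping.keys m \<subseteq> {..<n} \<and> int (mdeg m) = i"
  by (simp add: graded_def)

lemma graded_shift:
  assumes "graded n i a" "j < n"
  shows "graded n (i + 1) (shift j a)"
  unfolding graded_def
proof (intro allI impI)
  fix m assume *: "shift j a m \<noteq> 0"
  show "Poly_Mapping.keys m \<subseteq> {..<n} \<and> int (mdeg m) = i + 1"
  proof (cases rule: exponent_cases[of m j])
    case 1
    then show ?thesis using * by (simp add: shift_def)
  next
    case (2 m')
    then show ?thesis using * graded_D[OF assms(1), of m'] assms(2)
      by (simp add: keys_add_nat mdeg_add)
  qed
qed

lemma graded_zero: "graded n i (\<lambda>m. 0)"
  by (simp add: graded_def)

lemma add_nonzero_cases: "(x::'k::comm_ring_1) + y \<noteq> 0 \<Longrightarrow> x \<noteq> 0 \<or> y \<noteq> 0"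
  by auto

lemma graded_add:
  fixes a b :: "_ \<Rightarrow> 'k::comm_ring_1"
  shows "graded n i a \<Longrightarrow> graded n i b \<Longrightarrow> graded n i (\<lambda>m. a m + b m)"
  unfolding graded_def using add_nonzero_cases by blast

lemma graded_cmult:
  fixes a :: "_ \<Rightarrow> 'k::comm_ring_1"
  shows "graded n i a \<Longrightarrow> graded n i (\<lambda>m. c * a m)"
  unfolding graded_def using mult_not_zero by blast

lemma graded_diff:
  fixes a b :: "_ \<Rightarrow> 'k::comm_ring_1"
  shows "graded n i a \<Longrightarrow> graded n i b \<Longrightarrow> graded n i (\<lambda>m. a m - b m)"
  using graded_add[of n i a "\<lambda>m. (-1) * b m"] graded_cmult[of n i b "-1"] by simp

lemma graded_sum:
  fixes a :: "_ \<Rightarrow> _ \<Rightarrow> 'k::comm_ring_1"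
  shows "(\<And>j. j \<in> S \<Longrightarrow> graded n i (a j)) \<Longrightarrow> graded n i (\<lambda>m. \<Sum>j\<in>S. a j m)"
  by (induction S rule: infinite_finite_induct) (auto simp: graded_zero graded_add)

lemma graded_raise: "graded n i a \<Longrightarrow> graded n (i + 1) (raise n c a)"
  unfolding raise_def by (intro graded_sum graded_cmult graded_shift) auto

section \<open>From coefficient functions back to polynomials\<close>

lemma homog_part_iff: "f \<in> homog_part n i \<longleftrightarrow> graded n (int i) (Poly_Mapping.lookup f)"
  by (auto simp: homog_part_def in_vars_def homog_def graded_def in_keys_iff)

lemma mult_inj_if_raise_inj:
  assumes "raise_inj n d c (int i)"
  shows "mult_inj n d (linform n c) i"
  unfolding mult_inj_def
proof (intro ballI impI)
  fix f assume f: "f \<in> homog_part n i" and l: "in_ideal n d (linform n c * f)"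
  have "linform n c * f \<in> homog_part n (Suc i)"
    using graded_raise f unfolding homog_part_iff lookup_linform_times
    by (metis of_nat_Suc add.commute)
  then have "zero_on_box n d (raise n c (Poly_Mapping.lookup f))"
    using l by (simp add: homog_part_def in_ideal_iff lookup_linform_times zero_on_box_def)
  then have "zero_on_box n d (Poly_Mapping.lookup f)"
    using assms f by (simp add: raise_inj_def homog_part_iff)
  then show "in_ideal n d f"
    using f by (simp add: homog_part_def in_ideal_iff zero_on_box_def)
qed

text \<open>The box is closed under divisors; this is why multiplication by a variable preserves
  vanishing on the box.\<close>

lemma box_pred: "m + unit_exp j \<in> box n d \<Longrightarrow> m \<in> box n d"
  unfolding box_def by (auto simp: keys_add_nat lookup_add intro: le_less_trans[OF le_add1])

lemma shift_zero_on_box: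
  assumes "zero_on_box n d a"
  shows "zero_on_box n d (shift j a)"
  unfolding zero_on_box_def
proof
  fix m assume "m \<in> box n d"
  then show "shift j a m = 0"
    using assms by (cases rule: exponent_cases[of m j]) (auto simp: zero_on_box_def dest: box_pred)
qed

lemma raise_zero_on_box: "zero_on_box n d a \<Longrightarrow> zero_on_box n d (raise n c a)"
  using shift_zero_on_box[of n d a] by (simp add: zero_on_box_def raise_def)

lemma shift_diff: "shift j (\<lambda>m. a m - b m) m = shift j a m - (shift j b m :: 'k::comm_ring_1)"
  by (simp add: shift_def)

lemma raise_diff: "raise n c (\<lambda>m. a m - b m) m = raise n c a m - raise n c b m"
  by (simp add: raise_def shift_diff sum_subtractf algebra_simps)

lemma mult_surj_if_raise_surj:
  fixes c :: "nat \<Rightarrow> 'k::comm_ring_1"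
  assumes "raise_surj n d c (int i)"
  shows "mult_surj n d (linform n c) i"
  unfolding mult_surj_def
proof (intro ballI)
  fix g :: "'k mpoly" assume g: "g \<in> homog_part n (Suc i)"
  then have "graded n (int i + 1) (Poly_Mapping.lookup g)"
    by (simp add: homog_part_iff add.commute)
  then obtain a where a: "graded n (int i) a"
    "zero_on_box n d (\<lambda>m. Poly_Mapping.lookup g m - raise n c a m)"
    using assms unfolding raise_surj_def by blast
  \<comment> \<open>Cutting \<open>a\<close> off outside the finite box yields a polynomial; the
    part cut off represents zero, also after multiplication by the linear form.\<close>
  define f where "f = (\<Sum>m\<in>box n d. Poly_Mapping.single m (a m))"
  have look: "Poly_Mapping.lookup f m = (if m \<in> box n d then a m else 0)" for m
    unfolding f_def by (rule lookup_sum_single) (rule finite_box)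
  have f: "f \<in> homog_part n i"
    using a(1) by (auto simp: homog_part_iff graded_def look split: if_splits)
  have "zero_on_box n d (\<lambda>m. a m - Poly_Mapping.lookup f m)"
    by (simp add: zero_on_box_def look)
  then have "zero_on_box n d (raise n c (\<lambda>m. a m - Poly_Mapping.lookup f m))"
    by (rule raise_zero_on_box)
  then have 0: "zero_on_box n d (Poly_Mapping.lookup (g - linform n c * f))"
    using a(2) by (simp add: zero_on_box_def raise_diff lookup_minus lookup_linform_times)
  have "graded n (int i + 1) (Poly_Mapping.lookup (linform n c * f))"
    using f graded_raise by (auto simp: homog_part_iff lookup_linform_times)
  then have "graded n (int i + 1) (\<lambda>m. Poly_Mapping.lookup g m - Poly_Mapping.lookup (linform n c * f) m)"
    using \<open>graded n (int i + 1) (Poly_Mapping.lookup g)\<close> by (intro graded_diff)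
  then have "in_vars n (g - linform n c * f)"
    by (auto simp: in_vars_def graded_def in_keys_iff lookup_minus)
  then have "in_ideal n d (g - linform n c * f)"
    using 0 by (simp add: in_ideal_iff zero_on_box_def)
  then show "\<exists>f\<in>homog_part n i. in_ideal n d (g - linform n c * f)"
    using f by blast
qed

lemma shift_commute: "shift i (shift j a) m = shift j (shift i a) m"
  by (cases "i = j") (auto simp: shift_def lookup_minus diff_right_commute)

lemma shift_sum: "shift j (\<lambda>m. \<Sum>x\<in>S. a x m) m = (\<Sum>x\<in>S. shift j (a x) m :: 'k::comm_ring_1)"
  by (simp add: shift_def)

lemma shift_cmult: "shift j (\<lambda>m. c * a m) m = c * (shift j a m :: 'k::comm_ring_1)"
  by (simp add: shift_def)

lemma raise_shift: "raise n c (shift j a) m = shift j (raise n c a) m"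
  unfolding raise_def by (simp add: shift_sum shift_cmult shift_commute[of _ j])

lemma raise_cmult: "raise n c (\<lambda>m. r * a m) m = r * raise n c a m"
  by (simp add: raise_def shift_cmult sum_distrib_left mult.left_commute)

lemma raise_sum: "raise n c (\<lambda>m. \<Sum>x\<in>S. a x m) m = (\<Sum>x\<in>S. raise n c (a x) m)"
  unfolding raise_def by (simp add: shift_sum sum_distrib_left sum.swap[of _ S])

lemma raise_zero: "raise n c (\<lambda>m. 0) m = 0"
  by (simp add: raise_def shift_def)

section \<open>Passing between neighbouring degrees\<close>

lemma graded_translate:
  assumes "graded n (i + 1) g"
  shows "graded n i (\<lambda>m. g (m + unit_exp j))"
  unfolding graded_def
proof (intro allI impI)
  fix m assume "g (m + unit_exp j) \<noteq> 0"
  then show "Poly_Mapping.keys m \<subseteq> {..<n} \<and> int (mdeg m) = i"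
    using graded_D[OF assms, of "m + unit_exp j"] by (simp add: keys_add_nat mdeg_add)
qed

lemma box_mdeg: "m \<in> box n d \<Longrightarrow> mdeg m = (\<Sum>j<n. Poly_Mapping.lookup m j)"
  by (rule mdeg_eq_sum) (auto simp: box_def)

lemma box_add_unit_exp:
  "m \<in> box n d \<Longrightarrow> j < n \<Longrightarrow> Poly_Mapping.lookup m j + 1 < d j \<Longrightarrow> m + unit_exp j \<in> box n d"
  by (auto simp: box_def keys_add_nat lookup_add)

lemma box_mdeg_le:
  assumes "m \<in> box n d"
  shows "mdeg m \<le> (\<Sum>j<n. d j - 1)"
  unfolding box_mdeg[OF assms] using assms
  by (intro sum_mono) (fastforce simp: box_def)

text \<open>The socle of the quotient lives in the top degree, so an element of lower degree that is
  annihilated by all variables vanishes.\<close>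

lemma raise_inj_pred:
  assumes "raise_inj n d c (i + 1)" "i < int (\<Sum>j<n. d j - 1)"
  shows "raise_inj n d c i"
  unfolding raise_inj_def
proof (intro allI impI)
  fix a assume a: "graded n i a" "zero_on_box n d (raise n c a)"
  \<comment> \<open>Multiplication is commutative, so each variable times \<open>a\<close> lies in
    the kernel one degree higher, where the hypothesis kills it.\<close>
  have sh: "zero_on_box n d (shift j a)" if "j < n" for j
  proof -
    have "raise n c (shift j a) = shift j (raise n c a)"
      by (rule ext) (rule raise_shift)
    then have "zero_on_box n d (raise n c (shift j a))"
      using shift_zero_on_box[OF a(2)] by simp
    then show ?thesis
      using assms(1) graded_shift[OF a(1) that] unfolding raise_inj_def by blast
  qed
  show "zero_on_box n d a"
    unfolding zero_on_box_def
  proof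
    fix m assume m: "m \<in> box n d"
    show "a m = 0"
    proof (rule ccontr)
      assume "a m \<noteq> 0"
      then have deg: "int (mdeg m) = i" using graded_D[OF a(1)] by blast
      have "\<exists>j<n. Poly_Mapping.lookup m j + 1 < d j"
      proof (rule ccontr)
        assume "\<not> ?thesis"
        then have "(\<Sum>j<n. d j - 1) \<le> (\<Sum>j<n. Poly_Mapping.lookup m j)"
          by (intro sum_mono) force
        then show False using deg assms(2) box_mdeg[OF m] by linarith
      qed
      then obtain j where j: "j < n" "m + unit_exp j \<in> box n d"
        using box_add_unit_exp[OF m] by blast
      then have "shift j a (m + unit_exp j) = 0"
        using sh unfolding zero_on_box_def by blast
      then show False using \<open>a m \<noteq> 0\<close> by simp
    qed
  qed
qed

lemma raise_inj_below:
  assumes "raise_inj n d c (int k)" "k < (\<Sum>j<n. d j - 1)" "i \<le> k"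
  shows "raise_inj n d c (int i)"
  using assms(3)
proof (induction rule: inc_induct)
  case base
  then show ?case by (rule assms(1))
next
  case (step i)
  have "int i < int (\<Sum>j<n. d j - 1)" using step(2) assms(2) by linarith
  then show ?case using raise_inj_pred[of n d c "int i"] step(3) by (simp add: add.commute)
qed

text \<open>In positive degree \<open>g\<close> is a sum of variables times cofactors; preimages of
  the cofactors, multiplied by the same variables, add up to a preimage of \<open>g\<close>.\<close>

lemma raise_surj_succ:
  fixes c :: "nat \<Rightarrow> 'k::comm_ring_1"
  assumes "raise_surj n d c i" "i \<ge> 0"
  shows "raise_surj n d c (i + 1)"
  unfolding raise_surj_def
proof (intro allI impI)
  fix g :: "_ \<Rightarrow> 'k" assume g: "graded n (i + 1 + 1) g"
  \<comment> \<open>Assigning each monomial to its smallest variable makes it enter exactly one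
    cofactor \<open>h j\<close>.\<close>
  define first where "first m = (LEAST j. j \<in> Poly_Mapping.keys m)" for m :: "nat \<Rightarrow>\<^sub>0 nat"
  define h where "h j m = (if first (m + unit_exp j) = j then g (m + unit_exp j) else 0)" for j m
  have h: "graded n (i + 1) (h j)" for j
    using graded_translate[OF g, of j] by (auto simp: graded_def h_def split: if_splits)
  have first: "first m \<in> Poly_Mapping.keys m" if nz: "m \<noteq> 0" for m
  proof -
    obtain k where "k \<in> Poly_Mapping.keys m" using nz by fastforce
    then show ?thesis unfolding first_def by (rule LeastI)
  qed
  have decomp: "(\<Sum>j<n. shift j (h j) m) = g m" for m
  proof (cases "g m = 0")
    case True
    have "shift j (h j) m = 0" for j
      using True by (cases rule: exponent_cases[of m j]) (auto simp: h_def)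
    then show ?thesis using True by simp
  next
    case False
    then have m: "Poly_Mapping.keys m \<subseteq> {..<n}" "int (mdeg m) = i + 1 + 1"
      using g by (auto simp: graded_def)
    have "m \<noteq> 0" using m(2) assms(2) by auto
    have "shift j (h j) m = (if first m = j then g m else 0)" for j
    proof (cases rule: exponent_cases[of m j])
      case 1
      then show ?thesis using first[OF \<open>m \<noteq> 0\<close>] by (auto simp: in_keys_iff)
    next
      case (2 m')
      then show ?thesis by (simp add: h_def)
    qed
    moreover have "first m < n" using first[OF \<open>m \<noteq> 0\<close>] m(1) by auto
    ultimately show ?thesis by simp
  qed
  have "\<exists>a. graded n i a \<and> zero_on_box n d (\<lambda>m. h j m - raise n c a m)" for j
    using assms(1) h unfolding raise_surj_def by blast
  then obtain a where a: "\<And>j. graded n i (a j)"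
    "\<And>j. zero_on_box n d (\<lambda>m. h j m - raise n c (a j) m)" by metis
  let ?a = "\<lambda>m. \<Sum>j<n. shift j (a j) m"
  have "graded n (i + 1) ?a"
    by (intro graded_sum graded_shift a) simp
  moreover have "zero_on_box n d (\<lambda>m. g m - raise n c ?a m)"
  proof -
    have "g m - raise n c ?a m = (\<Sum>j<n. shift j (\<lambda>m. h j m - raise n c (a j) m) m)" for m
      by (simp add: raise_sum raise_shift shift_diff sum_subtractf flip: decomp)
    then show ?thesis
      using shift_zero_on_box[OF a(2)] by (simp add: zero_on_box_def)
  qed
  ultimately show "\<exists>a. graded n (i + 1) a \<and> zero_on_box n d (\<lambda>m. g m - raise n c a m)"
    by blast
qed

lemma raise_surj_above:
  assumes "raise_surj n d c (int k)" "k \<le> i"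
  shows "raise_surj n d c (int i)"
  using assms(2)
proof (induction rule: dec_induct)
  case base
  then show ?case by (rule assms(1))
next
  case (step i)
  then show ?case using raise_surj_succ[of n d c "int i"] by (simp add: add.commute)
qed

subsection \<open>One large exponent\<close>

lemma raise_indicator:
  assumes "l < n"
  shows "raise n (\<lambda>j. if j = l then 1 else 0) a = (shift l a :: _ \<Rightarrow> 'k::comm_ring_1)"
proof
  fix m
  have "(\<Sum>j<n. (if j = l then 1 else 0) * shift j a m) = (\<Sum>j<n. if j = l then shift j a m else 0)"
    by (rule sum.cong) auto
  then show "raise n (\<lambda>j. if j = l then 1 else 0) a m = shift l a m"
    using assms by (simp add: raise_def)
qed

text \<open>In degree \<open>i\<close> the exponent of variable \<open>l\<close> is at most
  \<open>i\<close>, so multiplying a box monomial by this variable does not leave the box.\<close>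

lemma raise_inj_indicator:
  assumes "l < n" "i < d l - 1"
  shows "raise_inj n d (\<lambda>j. if j = l then 1 else 0 :: 'k::comm_ring_1) (int i)"
  unfolding raise_inj_def raise_indicator[OF assms(1)]
proof (intro allI impI)
  fix a :: "_ \<Rightarrow> 'k" assume a: "graded n (int i) a" "zero_on_box n d (shift l a)"
  show "zero_on_box n d a"
    unfolding zero_on_box_def
  proof
    fix m assume m: "m \<in> box n d"
    show "a m = 0"
    proof (rule ccontr)
      assume "a m \<noteq> 0"
      then have "(\<Sum>j<n. Poly_Mapping.lookup m j) = i"
        using graded_D[OF a(1)] box_mdeg[OF m] by simp
      moreover have "Poly_Mapping.lookup m l \<le> (\<Sum>j<n. Poly_Mapping.lookup m j)"
        using assms(1) by (intro member_le_sum) auto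
      ultimately have "m + unit_exp l \<in> box n d"
        using assms by (intro box_add_unit_exp m) auto
      then have "shift l a (m + unit_exp l) = 0"
        using a(2) unfolding zero_on_box_def by blast
      then show False using \<open>a m \<noteq> 0\<close> by simp
    qed
  qed
qed

text \<open>A box monomial of degree \<open>i + 1\<close> cannot avoid variable \<open>l\<close>,
  since the others provide degree at most \<open>i\<close>; dividing by that variable gives the
  preimage.\<close>

lemma raise_surj_indicator:
  assumes "l < n" "(\<Sum>j\<in>{..<n} - {l}. d j - 1) \<le> i"
  shows "raise_surj n d (\<lambda>j. if j = l then 1 else 0 :: 'k::comm_ring_1) (int i)"
  unfolding raise_surj_def raise_indicator[OF assms(1)]
proof (intro allI impI)
  fix g :: "_ \<Rightarrow> 'k" assume g: "graded n (int i + 1) g"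
  let ?a = "\<lambda>m. g (m + unit_exp l)"
  have "graded n (int i) ?a"
    using g by (rule graded_translate)
  moreover have "zero_on_box n d (\<lambda>m. g m - shift l ?a m)"
    unfolding zero_on_box_def
  proof
    fix m assume m: "m \<in> box n d"
    show "g m - shift l ?a m = 0"
    proof (cases rule: exponent_cases[of m l])
      case 1
      have "mdeg m = (\<Sum>j\<in>{..<n} - {l}. Poly_Mapping.lookup m j)"
        using 1 assms(1) box_mdeg[OF m] by (simp add: sum.remove[of _ l])
      also have "\<dots> \<le> (\<Sum>j\<in>{..<n} - {l}. d j - 1)"
        using m by (intro sum_mono) (fastforce simp: box_def)
      finally have "g m = 0"
        using graded_D[OF g, of m] assms(2) by linarith
      then show ?thesis using 1 by simp
    next
      case (2 m')
      then show ?thesis by simp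
    qed
  qed
  ultimately show "\<exists>a. graded n (int i) a \<and> zero_on_box n d (\<lambda>m. g m - shift l a m)"
    by blast
qed

lemma has_WLP_large_exponent:
  assumes "l < n" "(\<Sum>j\<in>{..<n} - {l}. d j - 1) \<le> d l - 1"
  shows "has_WLP TYPE('k::comm_ring_1) n d"
  unfolding has_WLP_def
proof (intro exI allI)
  fix i
  let ?c = "\<lambda>j. if j = l then 1 else 0 :: 'k"
  show "mult_inj n d (linform n ?c) i \<or> mult_surj n d (linform n ?c) i"
  proof (cases "i < d l - 1")
    case True
    then show ?thesis using raise_inj_indicator[OF assms(1)] mult_inj_if_raise_inj by blast
  next
    case False
    then have "(\<Sum>j\<in>{..<n} - {l}. d j - 1) \<le> i" using assms(2) by linarith
    then show ?thesis using raise_surj_indicator[OF assms(1)] mult_surj_if_raise_surj by blast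
  qed
qed

subsection \<open>The lowering operator\<close>

text \<open>The monomial sent to \<open>m\<close> by variable \<open>j\<close> is
  \<open>m + unit_exp j\<close>, whose exponent e is the successor of that of \<open>m\<close>;
  hence the factor e (d_j - e). The difference is formed in the ring, where it is not
  truncated.\<close>

definition lower :: "nat \<Rightarrow> (nat \<Rightarrow> nat) \<Rightarrow> ((nat \<Rightarrow>\<^sub>0 nat) \<Rightarrow> 'k::comm_ring_1) \<Rightarrow> (nat \<Rightarrow>\<^sub>0 nat) \<Rightarrow> 'k" where
  "lower n d a m = (\<Sum>j<n. of_nat (Suc (Poly_Mapping.lookup m j)) *
     (of_nat (d j) - of_nat (Suc (Poly_Mapping.lookup m j))) * a (m + unit_exp j))"

abbreviation raise1 :: "nat \<Rightarrow> ((nat \<Rightarrow>\<^sub>0 nat) \<Rightarrow> 'k::comm_ring_1) \<Rightarrow> (nat \<Rightarrow>\<^sub>0 nat) \<Rightarrow> 'k" where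
  "raise1 n \<equiv> raise n (\<lambda>_. 1)"

text \<open>Operators of different variables commute; for one variable with exponent e the
  commutator is (e + 1)(d_j - e - 1) - e (d_j - e) = d_j - 1 - 2 e.\<close>

lemma lower_raise:
  "lower n d (raise1 n a) m = raise1 n (lower n d a) m +
     (\<Sum>j<n. of_nat (d j) - 1 - 2 * of_nat (Poly_Mapping.lookup m j)) * a m"
proof -
  let ?w = "\<lambda>j m. of_nat (Suc (Poly_Mapping.lookup m j)) *
     (of_nat (d j) - of_nat (Suc (Poly_Mapping.lookup m j)))"
  let ?h = "\<lambda>j. of_nat (d j) - 1 - 2 * of_nat (Poly_Mapping.lookup m j)"
  have comm: "?w j m * shift i a (m + unit_exp j) = shift i (\<lambda>m. ?w j m * a (m + unit_exp j)) m +
      (if i = j then ?h j * a m else 0)" for i j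
  proof (cases rule: exponent_cases[of m i])
    case 1
    show ?thesis
    proof (cases "i = j")
      case True
      then show ?thesis using 1 by simp
    next
      case False
      then show ?thesis using 1 by (simp add: lookup_add)
    qed
  next
    case (2 m')
    show ?thesis
    proof (cases "i = j")
      case True
      have "shift i a (m + unit_exp j) = a m" using True by simp
      then show ?thesis using 2 True
        by (simp only: shift_add refl if_True lookup_add lookup_unit_exp) (simp add: algebra_simps)
    next
      case False
      have "shift i a (m + unit_exp j) = a (m' + unit_exp j)"
        using shift_add[of i a "m' + unit_exp j"] 2 by (simp add: add_ac)
      then show ?thesis using False 2 by (simp add: lookup_add)
    qed
  qed
  have "lower n d (raise1 n a) m = (\<Sum>j<n. \<Sum>i<n. ?w j m * shift i a (m + unit_exp j))"
    by (simp only: lower_def raise_def sum_distrib_left mult_1)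
  also have "\<dots> = (\<Sum>j<n. \<Sum>i<n. shift i (\<lambda>m. ?w j m * a (m + unit_exp j)) m) + (\<Sum>j<n. ?h j * a m)"
    unfolding comm by (simp only: sum.distrib) simp
  also have "(\<Sum>j<n. \<Sum>i<n. shift i (\<lambda>m. ?w j m * a (m + unit_exp j)) m) =
      (\<Sum>i<n. shift i (\<lambda>m. \<Sum>j<n. ?w j m * a (m + unit_exp j)) m)"
    unfolding shift_sum by (rule sum.swap)
  also have "\<dots> = raise1 n (lower n d a) m"
    by (simp only: raise_def mult_1 lower_def[abs_def])
  finally show ?thesis by (simp only: sum_distrib_right)
qed

text \<open>Summed over the variables, the weights d_j - 1 - 2 e_j give t - 2 i. Positivity of
  \<open>d\<close> makes the natural number \<open>d j - 1\<close> agree with the difference in the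
  ring.\<close>

lemma lower_raise_graded:
  fixes a :: "_ \<Rightarrow> 'k::comm_ring_1"
  assumes "\<forall>j<n. d j > 0" "graded n i a"
  shows "lower n d (raise1 n a) m = raise1 n (lower n d a) m +
     of_int (int (\<Sum>j<n. d j - 1) - 2 * i) * a m"
proof (cases "a m = 0")
  case True
  then show ?thesis by (simp add: lower_raise)
next
  case False
  then have m: "Poly_Mapping.keys m \<subseteq> {..<n}" "int (mdeg m) = i"
    using assms(2) by (auto simp: graded_def)
  have "(\<Sum>j<n. of_nat (d j) - 1 - 2 * of_nat (Poly_Mapping.lookup m j)) =
      (\<Sum>j<n. of_nat (d j - 1) - 2 * of_nat (Poly_Mapping.lookup m j) :: 'k)"
    using assms(1) by (intro sum.cong) (auto simp: of_nat_diff Suc_le_eq)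
  also have "\<dots> = of_int (int (\<Sum>j<n. d j - 1) - 2 * int (mdeg m))"
    using mdeg_eq_sum[OF finite_lessThan m(1)]
    by (simp add: sum_subtractf sum_distrib_left)
  finally show ?thesis using m(2) by (simp add: lower_raise)
qed

lemma graded_lower:
  assumes "graded n i a"
  shows "graded n (i - 1) (lower n d a)"
  unfolding lower_def
proof (rule graded_sum)
  fix j
  have *: "graded n (i - 1) (\<lambda>m. a (m + unit_exp j))"
    using assms by (intro graded_translate) simp
  show "graded n (i - 1) (\<lambda>m. of_nat (Suc (Poly_Mapping.lookup m j)) *
      (of_nat (d j) - of_nat (Suc (Poly_Mapping.lookup m j))) * a (m + unit_exp j))"
    unfolding graded_def using graded_D[OF *] mult_not_zero by blast
qed

text \<open>The factor e (d_j - e) vanishes at e = d_j, exactly where \<open>m + unit_exp j\<close>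
  leaves the box, so the operator descends to the quotient.\<close>

lemma lower_zero_on_box:
  assumes "zero_on_box n d a"
  shows "zero_on_box n d (lower n d a)"
  unfolding zero_on_box_def
proof
  fix m assume m: "m \<in> box n d"
  show "lower n d a m = 0"
    unfolding lower_def
  proof (intro sum.neutral ballI)
    fix j assume j: "j \<in> {..<n}"
    show "of_nat (Suc (Poly_Mapping.lookup m j)) *
      (of_nat (d j) - of_nat (Suc (Poly_Mapping.lookup m j))) * a (m + unit_exp j) = 0"
    proof (cases "Poly_Mapping.lookup m j + 1 < d j")
      case True
      then have "m + unit_exp j \<in> box n d"
        using j by (intro box_add_unit_exp m) auto
      then show ?thesis using assms by (simp add: zero_on_box_def)
    next
      case False
      then have "d j = Suc (Poly_Mapping.lookup m j)"
        using m j by (force simp: box_def)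
      then show ?thesis by simp
    qed
  qed
qed

lemma lower_diff_cmult: "lower n d (\<lambda>m. a m - r * b m) m = lower n d a m - r * lower n d b m"
  by (simp add: lower_def sum_subtractf sum_distrib_left right_diff_distrib mult.left_commute
      del: of_nat_Suc)

lemma graded_raise_pow: "graded n i a \<Longrightarrow> graded n (i + int k) ((raise n c ^^ k) a)"
proof (induction k)
  case (Suc k)
  then show ?case using graded_raise[of n "i + int k"] by (simp add: add_ac)
qed simp

lemma graded_lower_pow: "graded n i a \<Longrightarrow> graded n (i - int k) ((lower n d ^^ k) a)"
proof (induction k)
  case (Suc k)
  then show ?case using graded_lower[of n "i - int k"] by (simp add: algebra_simps)
qed simp

lemma lower_pow_zero_on_box: "zero_on_box n d a \<Longrightarrow> zero_on_box n d ((lower n d ^^ k) a)"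
  by (induction k) (auto simp: lower_zero_on_box)

text \<open>Moving the raising operator past k + 1 lowerings collects the weights t - 2 (i - l) for
  l = 0, ..., k, whose sum is (k + 1)(t - 2 i + k).\<close>

lemma raise_lower_pow:
  fixes a :: "_ \<Rightarrow> 'k::comm_ring_1"
  assumes "\<forall>j<n. d j > 0" "graded n i a"
  shows "raise1 n ((lower n d ^^ Suc k) a) m = (lower n d ^^ Suc k) (raise1 n a) m -
     of_int ((int k + 1) * (int (\<Sum>j<n. d j - 1) - 2 * i + int k)) * (lower n d ^^ k) a m"
proof (induction k arbitrary: m)
  case 0
  then show ?case using lower_raise_graded[OF assms, of m] by simp
next
  case (Suc k)
  let ?T = "int (\<Sum>j<n. d j - 1)"
  let ?Y = "\<lambda>k. (lower n d ^^ k)"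
  have IH: "raise1 n (?Y (Suc k) a) = (\<lambda>m. ?Y (Suc k) (raise1 n a) m -
      of_int ((int k + 1) * (?T - 2 * i + int k)) * ?Y k a m)"
    by (rule ext) (rule Suc.IH)
  have "graded n (i - int (Suc k)) (?Y (Suc k) a)"
    by (rule graded_lower_pow) (rule assms(2))
  from lower_raise_graded[OF assms(1) this, of m]
  have "raise1 n (?Y (Suc (Suc k)) a) m =
      lower n d (raise1 n (?Y (Suc k) a)) m - of_int (?T - 2 * (i - int (Suc k))) * ?Y (Suc k) a m"
    by simp
  also have "lower n d (raise1 n (?Y (Suc k) a)) m = ?Y (Suc (Suc k)) (raise1 n a) m -
      of_int ((int k + 1) * (?T - 2 * i + int k)) * ?Y (Suc k) a m"
    unfolding IH lower_diff_cmult by simp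
  also have "\<dots> - of_int (?T - 2 * (i - int (Suc k))) * ?Y (Suc k) a m =
      ?Y (Suc (Suc k)) (raise1 n a) m -
      of_int ((int k + 1) * (?T - 2 * i + int k) + (?T - 2 * (i - int (Suc k)))) * ?Y (Suc k) a m"
    by (simp only: of_int_add distrib_right diff_diff_eq)
  also have "(int k + 1) * (?T - 2 * i + int k) + (?T - 2 * (i - int (Suc k))) =
      (int (Suc k) + 1) * (?T - 2 * i + int (Suc k))"
    by (simp add: algebra_simps)
  finally show ?case .
qed

subsection \<open>Powers of the sum of the variables\<close>

lemma lookup_linform_power:
  "Poly_Mapping.lookup (linform n c ^ k * f) = (raise n c ^^ k) (Poly_Mapping.lookup f)"
proof (induction k)
  case (Suc k)
  have "linform n c ^ Suc k * f = linform n c * (linform n c ^ k * f)"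
    by (simp add: mult.assoc)
  then show ?case by (simp only: lookup_linform_times Suc funpow.simps o_apply)
qed simp

lemma prod_fact_add_unit_exp:
  assumes "j < n"
  shows "(\<Prod>i<n. fact (Poly_Mapping.lookup (m + unit_exp j) i) :: nat) =
    Suc (Poly_Mapping.lookup m j) * (\<Prod>i<n. fact (Poly_Mapping.lookup m i))"
proof -
  have "(\<Prod>i\<in>{..<n} - {j}. fact (Poly_Mapping.lookup (m + unit_exp j) i) :: nat) =
    (\<Prod>i\<in>{..<n} - {j}. fact (Poly_Mapping.lookup m i))"
    by (rule prod.cong) (auto simp: lookup_add)
  then show ?thesis
    using assms by (simp add: prod.remove[of "{..<n}" j] lookup_add algebra_simps)
qed

text \<open>The multinomial formula with denominators cleared, as factorials need not be
  invertible.\<close>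

lemma multinomial_coeff:
  assumes "Poly_Mapping.keys m \<subseteq> {..<n}" "mdeg m = k"
  shows "Poly_Mapping.lookup (linform n (\<lambda>_. 1 :: 'k::comm_ring_1) ^ k) m *
    of_nat (\<Prod>j<n. fact (Poly_Mapping.lookup m j)) = of_nat (fact k)"
  using assms
proof (induction k arbitrary: m)
  case 0
  then show ?case by (simp add: mdeg_eq_0_iff)
next
  case (Suc k)
  let ?l = "linform n (\<lambda>_. 1 :: 'k)"
  let ?P = "\<lambda>m. of_nat (\<Prod>j<n. fact (Poly_Mapping.lookup m j)) :: 'k"
  \<comment> \<open>Removing one factor of variable \<open>j\<close> divides the product of
    factorials by the exponent of \<open>j\<close>, so this term contributes that exponent times
    \<open>fact k\<close>; the exponents sum to k + 1.\<close>
  have "shift j (Poly_Mapping.lookup (?l ^ k)) m * ?P m =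
      of_nat (Poly_Mapping.lookup m j) * of_nat (fact k)" if j: "j < n" for j
  proof (cases rule: exponent_cases[of m j])
    case 1
    then show ?thesis by simp
  next
    case (2 m')
    have "Poly_Mapping.lookup (?l ^ k) m' * ?P m' = of_nat (fact k)"
      using Suc.prems 2 by (intro Suc.IH) (auto simp: keys_add_nat mdeg_add)
    then show ?thesis
      unfolding 2 shift_add prod_fact_add_unit_exp[OF j] of_nat_mult
      by (simp add: lookup_add algebra_simps)
  qed
  then have "(\<Sum>j<n. shift j (Poly_Mapping.lookup (?l ^ k)) m * ?P m) =
      of_nat (\<Sum>j<n. Poly_Mapping.lookup m j) * of_nat (fact k)"
    by (simp add: sum_distrib_right)
  also have "(\<Sum>j<n. Poly_Mapping.lookup m j) = Suc k"
    using mdeg_eq_sum[OF finite_lessThan Suc.prems(1)] Suc.prems(2) by simp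
  finally show ?case
    by (simp add: lookup_linform_times raise_def sum_distrib_right distrib_right)
qed

text \<open>The coefficient is the multinomial coefficient of \<open>b\<close>, which divides the
  nonzero element \<open>of_nat (fact k)\<close>.\<close>

lemma raise_pow_monomial_nonzero:
  assumes "of_nat (fact k) \<noteq> (0 :: 'k::comm_ring_1)" "Poly_Mapping.keys b \<subseteq> {..<n}" "mdeg b = k"
  shows "(raise1 n ^^ k) (Poly_Mapping.lookup (Poly_Mapping.single m (1 :: 'k))) (m + b) \<noteq> 0"
proof -
  have "(raise1 n ^^ k) (Poly_Mapping.lookup (Poly_Mapping.single m (1 :: 'k))) (m + b) =
      Poly_Mapping.lookup (linform n (\<lambda>_. 1) ^ k) b"
    unfolding lookup_linform_power[symmetric]
    by (simp add: mult.commute[of _ "Poly_Mapping.single _ _"] lookup_single_times_add)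
  then show ?thesis using multinomial_coeff[OF assms(2,3), where 'k = 'k] assms(1) by auto
qed

section \<open>The top monomial and its divisors\<close>

definition top_exp :: "nat \<Rightarrow> (nat \<Rightarrow> nat) \<Rightarrow> (nat \<Rightarrow>\<^sub>0 nat)" where
  "top_exp n d = (\<Sum>j<n. Poly_Mapping.single j (d j - 1))"

lemma lookup_top_exp: "Poly_Mapping.lookup (top_exp n d) j = (if j < n then d j - 1 else 0)"
  unfolding top_exp_def by (simp add: lookup_sum_single)

lemma keys_top_exp: "Poly_Mapping.keys (top_exp n d) \<subseteq> {..<n}"
  by (auto simp: in_keys_iff lookup_top_exp split: if_splits)

lemma mdeg_top_exp: "mdeg (top_exp n d) = (\<Sum>j<n. d j - 1)"
  unfolding mdeg_eq_sum[OF finite_lessThan keys_top_exp] by (simp add: lookup_top_exp)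

text \<open>Maximal degree forces every exponent to its bound \<open>d j - 1\<close>. Thus a single
  coefficient decides vanishing in degree t.\<close>

lemma box_top_degree:
  assumes "m \<in> box n d" "mdeg m = (\<Sum>j<n. d j - 1)"
  shows "m = top_exp n d"
proof (rule poly_mapping_eqI)
  fix j
  show "Poly_Mapping.lookup m j = Poly_Mapping.lookup (top_exp n d) j"
  proof (cases "j < n")
    case True
    show ?thesis
    proof (rule ccontr)
      assume "Poly_Mapping.lookup m j \<noteq> Poly_Mapping.lookup (top_exp n d) j"
      moreover have le: "\<forall>i<n. Poly_Mapping.lookup m i \<le> d i - 1"
        using assms(1) by (fastforce simp: box_def)
      ultimately have "Poly_Mapping.lookup m j < d j - 1"
        using True by (simp add: lookup_top_exp le_neq_implies_less)
      then have "(\<Sum>i<n. Poly_Mapping.lookup m i) < (\<Sum>i<n. d i - 1)"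
        using True le by (intro sum_strict_mono_ex1) auto
      then show False using assms box_mdeg by fastforce
    qed
  next
    case False
    then show ?thesis using assms(1) by (auto simp: box_def lookup_top_exp in_keys_iff)
  qed
qed

text \<open>Variables are moved over one at a time. Applied to the top monomial, this supplies box
  monomials of prescribed degree.\<close>

lemma exponent_of_degree_below:
  assumes "r \<le> mdeg s"
  obtains m b where "s = m + b" "mdeg m = r"
proof -
  have "\<exists>m b. s = m + b \<and> mdeg m = r"
    using assms
  proof (induction r)
    case 0
    show ?case by (rule exI[of _ 0]) simp
  next
    case (Suc r)
    then obtain m b where mb: "s = m + b" "mdeg m = r" by auto
    then have "b \<noteq> 0" using Suc.prems by auto
    then obtain j where "j \<in> Poly_Mapping.keys b" by fastforce
    then obtain b' where "b = b' + unit_exp j"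
      by (cases rule: exponent_cases[of b j]) (auto simp: in_keys_iff)
    then have "s = (m + unit_exp j) + b'" "mdeg (m + unit_exp j) = Suc r"
      using mb by (simp_all add: add_ac mdeg_add)
    then show ?case by blast
  qed
  then show ?thesis using that by blast
qed

lemma box_below_top_exp:
  assumes "\<forall>j<n. d j > 0" "top_exp n d = m + b"
  shows "m \<in> box n d" "Poly_Mapping.keys m \<subseteq> {..<n}" "Poly_Mapping.keys b \<subseteq> {..<n}"
proof -
  show k: "Poly_Mapping.keys m \<subseteq> {..<n}" "Poly_Mapping.keys b \<subseteq> {..<n}"
    using keys_top_exp[of n d] by (simp_all add: assms(2) keys_add_nat)
  have "Poly_Mapping.lookup m j < d j" if "j < n" for j
  proof -
    have "Poly_Mapping.lookup m j + Poly_Mapping.lookup b j = d j - 1"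
      using lookup_top_exp[of n d j] that by (simp add: assms(2) lookup_add)
    moreover have "d j > 0" using assms(1) that by blast
    ultimately show ?thesis by linarith
  qed
  then show "m \<in> box n d" using k by (simp add: box_def)
qed

lemma of_nat_fact_nonzero:
  assumes "\<And>r. 0 < r \<Longrightarrow> r \<le> k \<Longrightarrow> of_nat r \<noteq> (0 :: 'k::field)"
  shows "of_nat (fact k) \<noteq> (0 :: 'k)"
  using assms
proof (induction k)
  case (Suc k)
  have "of_nat (fact k) \<noteq> (0 :: 'k)" using Suc.prems by (intro Suc.IH) simp
  moreover have "of_nat (Suc k) \<noteq> (0 :: 'k)" by (rule Suc.prems) simp_all
  ultimately show ?case by (simp only: fact_Suc of_nat_mult mult_eq_0_iff of_nat_id) simp
qed simp

subsection \<open>Large characteristic\<close>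

lemma of_int_nonzero:
  assumes "\<And>r. 0 < r \<Longrightarrow> r < p \<Longrightarrow> of_nat r \<noteq> (0 :: 'k::field)" "0 < z" "z < int p"
  shows "of_int z \<noteq> (0 :: 'k)"
proof -
  have "of_nat (nat z) \<noteq> (0 :: 'k)" by (rule assms(1)) (use assms(2,3) in linarith)+
  then show ?thesis using assms(2) by simp
qed

text \<open>Here \<open>lower ^ i\<close> maps an element \<open>a\<close> of the kernel to a constant, and the commutation
  relation recovers \<open>a\<close> from it as a multiple of the \<open>i\<close>-th power of the sum of the variables,
  so it remains to see that the next power is nonzero.\<close>

lemma raise_inj_middle:
  fixes n p :: nat and d :: "nat \<Rightarrow> nat"
  defines "t \<equiv> \<Sum>j<n. d j - 1"
  assumes d: "\<forall>j<n. d j > 0"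
    and p: "\<And>r. 0 < r \<Longrightarrow> r < p \<Longrightarrow> of_nat r \<noteq> (0 :: 'k::field)"
    and i: "2 * i < t" "i + 1 < p" "t \<le> p + i"
  shows "raise_inj n d (\<lambda>_. 1 :: 'k) (int i)"
  unfolding raise_inj_def
proof (intro allI impI)
  fix a :: "_ \<Rightarrow> 'k"
  assume a: "graded n (int i) a" "zero_on_box n d (raise1 n a)"
  let ?one = "Poly_Mapping.lookup (Poly_Mapping.single 0 (1 :: 'k))"
  let ?Y = "\<lambda>k. lower n d ^^ k" and ?X = "\<lambda>k. raise1 n ^^ k"
  have "\<exists>\<beta>. zero_on_box n d (\<lambda>m. ?Y (i - k) a m - \<beta> * ?X k ?one m)" if "k \<le> i" for k
    using that
  proof (induction k)
    case 0
    have "graded n 0 (?Y i a)" using graded_lower_pow[OF a(1), where k = i] by simp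
    then have "?Y i a m - ?Y i a 0 * ?one m = 0" for m
      by (cases "m = 0") (auto simp: graded_def lookup_one when_def mdeg_eq_0_iff)
    then show ?case unfolding zero_on_box_def funpow_0 diff_zero by blast
  next
    case (Suc k)
    define q where "q = i - Suc k"
    have q: "i - k = Suc q" using Suc.prems by (simp add: q_def)
    obtain \<beta> where \<beta>: "zero_on_box n d (\<lambda>m. ?Y (Suc q) a m - \<beta> * ?X k ?one m)"
      using Suc.IH[OF Suc_leD[OF Suc.prems]] unfolding q by blast
    define c :: 'k where "c = of_int ((int q + 1) * (int t - 2 * int i + int q))"
    \<comment> \<open>Both factors lie strictly between 0 and p: q + 1 <= i, and 0 < t - 2 i + q < t
      - i <= p because q < i.\<close>
    have "of_int (int q + 1) \<noteq> (0 :: 'k)"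
      by (rule of_int_nonzero[OF p]) (use i Suc.prems in \<open>auto simp: q_def\<close>)
    moreover have "of_int (int t - 2 * int i + int q) \<noteq> (0 :: 'k)"
      by (rule of_int_nonzero[OF p]) (use i Suc.prems in \<open>auto simp: q_def\<close>)
    ultimately have c: "c \<noteq> 0" by (simp only: c_def of_int_mult mult_eq_0_iff) simp
    have XY: "raise1 n (?Y (Suc q) a) m = ?Y (Suc q) (raise1 n a) m - c * ?Y q a m" for m
      unfolding c_def t_def by (rule raise_lower_pow[OF d a(1)])
    have 1: "zero_on_box n d (?Y (Suc q) (raise1 n a))"
      by (rule lower_pow_zero_on_box) (rule a(2))
    have 2: "zero_on_box n d (\<lambda>m. raise1 n (?Y (Suc q) a) m - \<beta> * ?X (Suc k) ?one m)"
      using raise_zero_on_box[OF \<beta>, of "\<lambda>_. 1"] by (simp add: zero_on_box_def raise_diff raise_cmult)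
    \<comment> \<open>On the box, raising kills \<open>a\<close>, so raising
      \<open>?Y (Suc q) a\<close> gives \<open>- c * ?Y q a\<close>; by induction it also gives
      \<beta> times the next power. Division by \<open>- c\<close> yields the new constant.\<close>
    have "?Y q a m - (- \<beta> / c) * ?X (Suc k) ?one m = 0" if "m \<in> box n d" for m
    proof -
      have "raise1 n (?Y (Suc q) a) m = \<beta> * ?X (Suc k) ?one m"
        using 2 that by (simp add: zero_on_box_def)
      moreover have "raise1 n (?Y (Suc q) a) m = - (c * ?Y q a m)"
        using 1 that XY[of m] by (simp add: zero_on_box_def)
      ultimately have "c * ?Y q a m = - \<beta> * ?X (Suc k) ?one m" by simp
      then show ?thesis using c by (simp add: field_simps)
    qed
    then show ?case unfolding q_def[symmetric] by (intro exI[of _ "- \<beta> / c"]) (simp add: zero_on_box_def)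
  qed
  from this[of i] obtain \<beta> where \<beta>: "zero_on_box n d (\<lambda>m. a m - \<beta> * ?X i ?one m)" by auto
  have X: "zero_on_box n d (\<lambda>m. raise1 n a m - \<beta> * ?X (Suc i) ?one m)"
    using raise_zero_on_box[OF \<beta>, of "\<lambda>_. 1"] by (simp add: zero_on_box_def raise_diff raise_cmult)
  \<comment> \<open>At a divisor of degree i + 1 of the top monomial the next power has a nonzero
    coefficient, since i + 1 < p; as \<beta> times it vanishes there, \<beta> is 0.\<close>
  have "Suc i \<le> mdeg (top_exp n d)" using i by (simp add: mdeg_top_exp t_def)
  then obtain m b where mb: "top_exp n d = m + b" "mdeg m = Suc i"
    by (rule exponent_of_degree_below)
  note m = box_below_top_exp[OF d mb(1)]
  have "of_nat (fact (Suc i)) \<noteq> (0 :: 'k)"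
    by (rule of_nat_fact_nonzero) (use p i in auto)
  then have "?X (Suc i) ?one (0 + m) \<noteq> 0"
    using m mb(2) by (intro raise_pow_monomial_nonzero)
  moreover have "raise1 n a m - \<beta> * ?X (Suc i) ?one m = 0" "raise1 n a m = 0"
    using X a(2) m(1) unfolding zero_on_box_def by blast+
  ultimately have "\<beta> = 0" by simp
  then show "zero_on_box n d a" using \<beta> by simp
qed

text \<open>Modulo the image, \<open>g\<close> may be changed so that the power of the sum of the variables leading
  to the top degree annihilates it; then the commutation relation expresses \<open>g\<close> through the
  image.\<close>

lemma raise_surj_middle:
  fixes n p :: nat and d :: "nat \<Rightarrow> nat"
  defines "t \<equiv> \<Sum>j<n. d j - 1"
  assumes d: "\<forall>j<n. d j > 0"
    and p: "\<And>r. 0 < r \<Longrightarrow> r < p \<Longrightarrow> of_nat r \<noteq> (0 :: 'k::field)"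
    and i: "t \<le> 2 * i + 1" "i < p" "t < p + i"
  shows "raise_surj n d (\<lambda>_. 1 :: 'k) (int i)"
  unfolding raise_surj_def
proof (intro allI impI)
  fix g :: "_ \<Rightarrow> 'k"
  assume g: "graded n (int i + 1) g"
  let ?Y = "\<lambda>k. lower n d ^^ k" and ?X = "\<lambda>k. raise1 n ^^ k"
  show "\<exists>a. graded n (int i) a \<and> zero_on_box n d (\<lambda>m. g m - raise1 n a m)"
  proof (cases "i < t")
    case False
    have "g m = 0" if "m \<in> box n d" for m
      using graded_D[OF g, of m] box_mdeg_le[OF that] False unfolding t_def by linarith
    then show ?thesis
      by (intro exI[of _ "\<lambda>_. 0"]) (simp add: graded_zero zero_on_box_def raise_zero)
  next
    case True
    \<comment> \<open>The number of raisings from the degree of \<open>g\<close> to the top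
      degree.\<close>
    define K where "K = t - (i + 1)"
    \<comment> \<open>A divisor of the top monomial serves as corrector: raising it K + 1 = t - i <
      p times gives a nonzero top coefficient.\<close>
    have "i \<le> mdeg (top_exp n d)" using True by (simp add: mdeg_top_exp t_def)
    then obtain m\<^sub>0 b where mb: "top_exp n d = m\<^sub>0 + b" "mdeg m\<^sub>0 = i"
      by (rule exponent_of_degree_below)
    note m\<^sub>0 = box_below_top_exp[OF d mb(1)]
    have b: "mdeg b = Suc K"
      using mdeg_top_exp[of n d] True mb by (simp add: mdeg_add K_def t_def)
    let ?u = "Poly_Mapping.lookup (Poly_Mapping.single m\<^sub>0 (1 :: 'k))"
    let ?\<sigma> = "top_exp n d"
    have u: "graded n (int i) ?u"
      using m\<^sub>0(2) mb(2) by (auto simp: graded_def lookup_single when_def)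
    have "of_nat (fact (Suc K)) \<noteq> (0 :: 'k)"
      by (rule of_nat_fact_nonzero) (use p i True in \<open>auto simp: K_def\<close>)
    then have nz: "?X (Suc K) ?u ?\<sigma> \<noteq> 0"
      unfolding mb(1) by (intro raise_pow_monomial_nonzero m\<^sub>0(3) b)
    \<comment> \<open>Chosen so that the top coefficient of \<open>?X K g'\<close> cancels.\<close>
    define \<mu> where "\<mu> = ?X K g ?\<sigma> / ?X (Suc K) ?u ?\<sigma>"
    define g' where "g' = (\<lambda>m. g m - raise1 n (\<lambda>m. \<mu> * ?u m) m)"
    have g': "graded n (int i + 1) g'"
      unfolding g'_def by (intro graded_diff graded_raise graded_cmult g u)
    have Xg': "?X k g' m = ?X k g m - \<mu> * ?X (Suc k) ?u m" for k m
    proof (induction k arbitrary: m)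
      case 0
      then show ?case by (simp add: g'_def raise_cmult)
    next
      case (Suc k)
      then have "?X k g' = (\<lambda>m. ?X k g m - \<mu> * ?X (Suc k) ?u m)" by blast
      then show ?case by (simp add: raise_diff raise_cmult)
    qed
    have top: "zero_on_box n d (?X K g')"
      unfolding zero_on_box_def
    proof
      fix m assume m: "m \<in> box n d"
      show "?X K g' m = 0"
      proof (cases "mdeg m = t")
        case True
        then have "m = ?\<sigma>" using box_top_degree[OF m] by (simp add: t_def)
        then show ?thesis using nz by (simp add: Xg' \<mu>_def)
      next
        case False
        have "graded n (int i + 1 + int K) (?X K g')"
          by (rule graded_raise_pow) (rule g')
        moreover have "int (mdeg m) \<noteq> int i + 1 + int K"
          using False \<open>i < t\<close> by (simp add: K_def)
        ultimately show ?thesis by (meson graded_D)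
      qed
    qed
    \<comment> \<open>Descending induction from k = K, where the expression vanishes on the box, to
      k = 0, where it is \<open>g'\<close>.\<close>
    have "\<exists>a. graded n (int i) a \<and> zero_on_box n d (\<lambda>m. ?Y k (?X k g') m - raise1 n a m)"
      if "k \<le> K" for k
      using that
    proof (induction rule: inc_induct)
      case base
      have "zero_on_box n d (?Y K (?X K g'))" by (rule lower_pow_zero_on_box) (rule top)
      then show ?case
        by (intro exI[of _ "\<lambda>_. 0"]) (simp add: graded_zero zero_on_box_def raise_zero)
    next
      case (step k)
      then obtain a where a: "graded n (int i) a"
        "zero_on_box n d (\<lambda>m. ?Y (Suc k) (?X (Suc k) g') m - raise1 n a m)" by blast
      define h where "h = ?X k g'"
      have h: "graded n (int i + 1 + int k) h"
        unfolding h_def by (rule graded_raise_pow) (rule g')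
      define c :: 'k where "c = of_int ((int k + 1) * (int t - 2 * (int i + 1 + int k) + int k))"
      \<comment> \<open>Here k + 1 <= K < p. The second factor is negative, hence the sign: 2 i + 2
        + k - t is positive since t <= 2 i + 1, and at most i < p since k < K.\<close>
      have "of_int (int k + 1) \<noteq> (0 :: 'k)"
        by (rule of_int_nonzero[OF p]) (use i step(2) in \<open>auto simp: K_def\<close>)
      moreover have "of_int (- (int t - 2 * (int i + 1 + int k) + int k)) \<noteq> (0 :: 'k)"
        by (rule of_int_nonzero[OF p]) (use i step(2) in \<open>auto simp: K_def\<close>)
      ultimately have c: "c \<noteq> 0"
        by (simp only: c_def of_int_mult mult_eq_0_iff of_int_minus neg_equal_0_iff_equal) simp
      have XY: "raise1 n (?Y (Suc k) h) m = ?Y (Suc k) (raise1 n h) m - c * ?Y k h m" for m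
        unfolding c_def t_def by (rule raise_lower_pow[OF d h])
      have Xh: "raise1 n h = ?X (Suc k) g'" by (simp add: h_def)
      \<comment> \<open>The commutation relation solved for \<open>?Y k h\<close>, with
        \<open>a\<close> a preimage of the next stage.\<close>
      let ?a = "\<lambda>m. (1 / c) * (a m - ?Y (Suc k) h m)"
      have "graded n (int i + 1 + int k - int (Suc k)) (?Y (Suc k) h)"
        by (rule graded_lower_pow) (rule h)
      then have "graded n (int i) (?Y (Suc k) h)" by simp
      then have "graded n (int i) ?a" by (intro graded_cmult graded_diff a(1))
      moreover have "?Y k h m - raise1 n ?a m = 0" if "m \<in> box n d" for m
      proof -
        have "?Y (Suc k) (raise1 n h) m = raise1 n a m"
          using a(2) that unfolding Xh by (simp add: zero_on_box_def)
        then have "c * ?Y k h m = raise1 n a m - raise1 n (?Y (Suc k) h) m"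
          using XY[of m] by simp
        moreover have "raise1 n ?a m = (1 / c) * (raise1 n a m - raise1 n (?Y (Suc k) h) m)"
          by (simp only: raise_cmult raise_diff)
        moreover have "(1 / c) * (c * y) = y" for y using c by simp
        ultimately show ?thesis by (metis diff_self)
      qed
      ultimately show ?case
        unfolding h_def[symmetric] by (intro exI[of _ ?a]) (simp add: zero_on_box_def)
    qed
    from this[of 0] obtain a where a: "graded n (int i) a"
      "zero_on_box n d (\<lambda>m. g' m - raise1 n a m)" by auto
    \<comment> \<open>Undoes the correction by \<open>?u\<close>; the sum is written as a difference
      to fit \<open>graded_diff\<close>.\<close>
    let ?a = "\<lambda>m. a m - (- \<mu>) * ?u m"
    have "graded n (int i) ?a" by (intro graded_diff graded_cmult a(1) u)
    moreover have "g m - raise1 n ?a m = g' m - raise1 n a m" for m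
      unfolding g'_def raise_diff raise_cmult by simp
    ultimately show ?thesis
      using a(2) by (intro exI[of _ ?a]) simp
  qed
qed

text \<open>One degree of each kind suffices: injectivity at the last degree with 2 i < t is pushed
  down, surjectivity at the floor of t / 2 is pushed up.\<close>

lemma has_WLP_large_char:
  fixes n p :: nat and d :: "nat \<Rightarrow> nat"
  assumes d: "\<forall>j<n. d j > 0"
    and p: "\<And>r. 0 < r \<Longrightarrow> r < p \<Longrightarrow> of_nat r \<noteq> (0 :: 'k::field)"
    and pt: "(\<Sum>j<n. d j - 1) + 1 < 2 * p"
  shows "has_WLP TYPE('k) n d"
  unfolding has_WLP_def
proof (intro exI allI)
  fix i
  let ?t = "\<Sum>j<n. d j - 1"
  let ?l = "linform n (\<lambda>_. 1 :: 'k)"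
  show "mult_inj n d ?l i \<or> mult_surj n d ?l i"
  proof (cases "2 * i < ?t")
    case True
    \<comment> \<open>Stated for a variable \<open>t\<close>, which keeps the sum out of the
      arithmetic.\<close>
    have mid: "2 * ((t - 1) div 2) < t" "(t - 1) div 2 + 1 < p" "t \<le> p + (t - 1) div 2"
      "(t - 1) div 2 < t" "i \<le> (t - 1) div 2" if "2 * i < t" "t + 1 < 2 * p" for t
      using that by presburger+
    have "raise_inj n d (\<lambda>_. 1 :: 'k) (int ((?t - 1) div 2))"
      by (rule raise_inj_middle[where p = p, OF d]) (erule (1) p | rule mid[OF True pt])+
    then have "raise_inj n d (\<lambda>_. 1 :: 'k) (int i)"
      by (rule raise_inj_below) (rule mid[OF True pt])+
    then show ?thesis using mult_inj_if_raise_inj by blast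
  next
    case False
    have mid: "t \<le> 2 * (t div 2) + 1" "t div 2 < p" "t < p + t div 2"
      if "t + 1 < 2 * p" for t
      using that by presburger+
    have "raise_surj n d (\<lambda>_. 1 :: 'k) (int (?t div 2))"
      by (rule raise_surj_middle[where p = p, OF d]) (erule (1) p | rule mid[OF pt])+
    then have "raise_surj n d (\<lambda>_. 1 :: 'k) (int i)"
      by (rule raise_surj_above) (use False in linarith)
    then show ?thesis using mult_surj_if_raise_surj by blast
  qed
qed

theorem theorem4p4:
  fixes n p :: nat and d :: "nat \<Rightarrow> nat"
  assumes "CHAR('k::field) = p" and "p > 0"
    and "\<forall>j<n. d j > 0"
    and "real (Max ({p} \<union> d ` {..<n})) > (real (\<Sum>j<n. d j - 1) + 1) / 2"
  shows "has_WLP TYPE('k) n d"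
proof -
  let ?t = "\<Sum>j<n. d j - 1"
  define M where "M = Max ({p} \<union> d ` {..<n})"
  have "(real ?t + 1) / 2 < real M" unfolding M_def by (rule assms(4))
  then have "real (?t + 1) < real (2 * M)" by simp
  then have M: "?t + 1 < 2 * M" by (simp only: of_nat_less_iff)
  have "M \<in> {p} \<union> d ` {..<n}" unfolding M_def by (rule Max_in) auto
  then consider "M = p" | l where "l < n" "M = d l" by auto
  then show ?thesis
  proof cases
    case 1
    show ?thesis
    proof (rule has_WLP_large_char)
      show "of_nat r \<noteq> (0 :: 'k)" if "0 < r" "r < p" for r
        using that assms(1) by (auto simp: of_nat_eq_0_iff_char_dvd dest: dvd_imp_le)
    qed (use assms(3) M 1 in simp_all)
  next
    case (2 l)
    \<comment> \<open>With t + 1 < 2 d_l this splitting leaves less than d_l for the remaining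
      variables.\<close>
    have "?t = (d l - 1) + (\<Sum>j\<in>{..<n} - {l}. d j - 1)"
      using 2 by (simp add: sum.remove[of _ l])
    moreover have "d l > 0" using 2 assms(3) by blast
    ultimately have "(\<Sum>j\<in>{..<n} - {l}. d j - 1) \<le> d l - 1"
      using M 2 by linarith
    then show ?thesis by (rule has_WLP_large_exponent[OF 2(1)])
  qed
qed

end
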